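(* Let $G$ be a connected graph with at least one edge and let $u \in V(G)$. For integers $p \geq q \geq 1$ and $0 \leq \alpha < 1$, $$\rho_\alpha(G_u(p,q)) > \rho_\alpha(G_u(p+1,q-1)).$$
   Context: All graphs are finite, simple and undirected. For a graph $G$, $A(G)$ is its adjacency matrix and $D(G)$ the diagonal matrix of vertex degrees. For $\alpha\in[0,1]$, $A_\alpha(G) = \alpha D(G) + (1-\alpha)A(G)$, and $\rho_\alpha(G)$ is the largest eigenvalue of $A_\alpha(G)$. For a positive integer $p$ and $u\in V(G)$, $G(u;p)$ is the graph obtained from $G$ by attaching a pendant path of length $p$ at $u$ (i.e., adding new vertices $w_1,\dots,w_p$ and edges $uw_1, w_1w_2,\dots,w_{p-1}w_p$), and $G(u;0)=G$. For nonnegative integers $p,q$, $G_u(p,q)$ is the graph $H(u;q)$ where $H = G(u;p)$; i.e., two vertex-disjoint pendant paths of lengths $p$ and $q$ attached at $u$. *)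

theory Defs
  imports "Graph_Theory.Graph_Theory" "Jordan_Normal_Form.Char_Poly"
begin

text \<open>A finite simple undirected graph is a \<^locale>\<open>pair_graph\<close>: every edge is
  represented by the two arcs in opposite directions, so the degree of a vertex is its out-degree.\<close>

text \<open>Matrices are indexed by natural numbers, so a graph on an arbitrary vertex type has to be
  equipped with an ordering of its vertices. The eigenvalues do not depend on the choice, see
  \<open>eigenvalue_A_alpha_iff\<close> below.\<close>

definition vertex_list :: "'a pair_pre_digraph \<Rightarrow> 'a list" where
  "vertex_list G = (SOME vs. distinct vs \<and> set vs = pverts G)"

definition adj_matrix :: "'a pair_pre_digraph \<Rightarrow> real mat" where
  "adj_matrix G = (let vs = vertex_list G; n = length vs in
     mat n n (\<lambda>(i, j). if (vs ! i, vs ! j) \<in> parcs G then 1 else 0))"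

definition deg_matrix :: "'a pair_pre_digraph \<Rightarrow> real mat" where
  "deg_matrix G = (let vs = vertex_list G; n = length vs in
     mat n n (\<lambda>(i, j). if i = j then real (out_degree (with_proj G) (vs ! i)) else 0))"

definition A_alpha :: "real \<Rightarrow> 'a pair_pre_digraph \<Rightarrow> real mat" where
  "A_alpha \<alpha> G = \<alpha> \<cdot>\<^sub>m deg_matrix G + (1 - \<alpha>) \<cdot>\<^sub>m adj_matrix G"

definition rho :: "real \<Rightarrow> 'a pair_pre_digraph \<Rightarrow> real" where
  "rho \<alpha> G = Max {k. eigenvalue (A_alpha \<alpha> G) k}"

text \<open>The walk \<open>u, w\<^sub>1, w\<^sub>2, \<dots>\<close> along the attached path, where \<open>w\<^sub>i = Inr i\<close>.\<close>

definition path_vertex :: "'a \<Rightarrow> nat \<Rightarrow> 'a + nat" where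
  "path_vertex u i = (if i = 0 then Inl u else Inr i)"

definition attach_path :: "'a pair_pre_digraph \<Rightarrow> 'a \<Rightarrow> nat \<Rightarrow> ('a + nat) pair_pre_digraph" where
  "attach_path G u p = \<lparr>
     pverts = Inl ` pverts G \<union> Inr ` {1..p},
     parcs = map_prod Inl Inl ` parcs G
       \<union> (\<Union>i<p. {(path_vertex u i, path_vertex u (Suc i)),
                 (path_vertex u (Suc i), path_vertex u i)}) \<rparr>"

definition attach_two_paths ::
    "'a pair_pre_digraph \<Rightarrow> 'a \<Rightarrow> nat \<Rightarrow> nat \<Rightarrow> (('a + nat) + nat) pair_pre_digraph" where
  "attach_two_paths G u p q = attach_path (attach_path G u p) (Inl u) q"

lemma pair_graph_attach_path:
  assumes "pair_graph G" "u \<in> pverts G"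
  shows "pair_graph (attach_path G u p)"
proof -
  interpret pair_graph G by fact
  have sym: "(y, x) \<in> parcs G" if "(x, y) \<in> parcs G" for x y
    using that pair_sym_arcs by (auto simp: symmetric_def sym_def)
  have v: "path_vertex u i \<in> pverts (attach_path G u p)" if "i \<le> p" for i
    using that assms(2) by (auto simp: path_vertex_def attach_path_def)
  have wf: "fst e \<in> pverts (attach_path G u p) \<and> snd e \<in> pverts (attach_path G u p)
      \<and> fst e \<noteq> snd e" if e: "e \<in> parcs (attach_path G u p)" for e
  proof (cases "e \<in> map_prod Inl Inl ` parcs G")
    case True
    then obtain a where a: "a \<in> parcs G" "e = map_prod Inl Inl a" by auto
    then show ?thesis
      using arc_fst_in_verts[of a] arc_snd_in_verts[of a] pair_no_loops[of a]
      by (cases a) (auto simp: attach_path_def)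
  next
    case False
    then obtain i where "i < p" "e = (path_vertex u i, path_vertex u (Suc i)) \<or>
        e = (path_vertex u (Suc i), path_vertex u i)"
      using e by (auto simp: attach_path_def)
    then show ?thesis using v[of i] v[of "Suc i"] by (auto simp: path_vertex_def split: if_splits)
  qed
  have "symmetric (with_proj (attach_path G u p))"
    unfolding symmetric_def with_proj_simps
  proof (rule symI)
    fix x y assume e: "(x, y) \<in> parcs (attach_path G u p)"
    show "(y, x) \<in> parcs (attach_path G u p)"
    proof (cases "(x, y) \<in> map_prod Inl Inl ` parcs G")
      case True
      then obtain a b where "(a, b) \<in> parcs G" "x = Inl a" "y = Inl b" by auto
      then show ?thesis using sym[of a b] by (force simp: attach_path_def)
    next
      case False
      then show ?thesis using e by (auto simp: attach_path_def)
    qed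
  qed
  moreover have "finite (pverts (attach_path G u p))" "finite (parcs (attach_path G u p))"
    using pair_finite_verts pair_finite_arcs by (auto simp: attach_path_def)
  ultimately show ?thesis by unfold_locales (use wf in auto)
qed

lemma vertex_list:
  assumes "finite (pverts G)"
  shows "distinct (vertex_list G)" "set (vertex_list G) = pverts G"
proof -
  have "\<exists>vs. distinct vs \<and> set vs = pverts G"
    using finite_distinct_list[OF assms] by blast
  from someI_ex[OF this] show "distinct (vertex_list G)" "set (vertex_list G) = pverts G"
    unfolding vertex_list_def by auto
qed

lemma eigenvalue_A_alpha_iff:
  assumes "finite (pverts G)"
  shows "eigenvalue (A_alpha \<alpha> G) k \<longleftrightarrow>
    (\<exists>x. (\<exists>v \<in> pverts G. x v \<noteq> 0) \<and>
      (\<forall>v \<in> pverts G. \<alpha> * real (out_degree (with_proj G) v) * x v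
         + (1 - \<alpha>) * (\<Sum>w \<in> {w \<in> pverts G. (v, w) \<in> parcs G}. x w) = k * x v))"
    (is "_ \<longleftrightarrow> (\<exists>x. ?P x)")
proof -
  define vs where "vs = vertex_list G"
  define n where "n = length vs"
  note vl = vertex_list[OF assms, folded vs_def]
  have dim: "dim_row (A_alpha \<alpha> G) = n" "dim_col (A_alpha \<alpha> G) = n"
    by (auto simp: A_alpha_def deg_matrix_def adj_matrix_def Let_def n_def vs_def)
  have bij: "bij_betw ((!) vs) {..<n} (pverts G)"
    using bij_betw_nth[OF vl(1)] vl(2) n_def by auto
  have entry: "A_alpha \<alpha> G $$ (i, j) =
      (if i = j then \<alpha> * real (out_degree (with_proj G) (vs ! i)) else 0)
      + (1 - \<alpha>) * (if (vs ! i, vs ! j) \<in> parcs G then 1 else 0)" if "i < n" "j < n" for i j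
    using that by (simp add: A_alpha_def deg_matrix_def adj_matrix_def Let_def n_def vs_def)
  have mult: "(A_alpha \<alpha> G *\<^sub>v y) $ i = \<alpha> * real (out_degree (with_proj G) (vs ! i)) * x (vs ! i)
      + (1 - \<alpha>) * (\<Sum>w \<in> {w \<in> pverts G. (vs ! i, w) \<in> parcs G}. x w)"
    if i: "i < n" and y: "y \<in> carrier_vec n" "\<And>j. j < n \<Longrightarrow> y $ j = x (vs ! j)" for i x y
  proof -
    have "(A_alpha \<alpha> G *\<^sub>v y) $ i = (\<Sum>j<n. A_alpha \<alpha> G $$ (i, j) * y $ j)"
      using i y dim by (simp add: scalar_prod_def atLeast0LessThan)
    also have "\<dots> = (\<Sum>j<n. (if i = j then \<alpha> * real (out_degree (with_proj G) (vs ! i)) * x (vs ! j) else 0)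
        + (1 - \<alpha>) * (if (vs ! i, vs ! j) \<in> parcs G then x (vs ! j) else 0))"
      using i y by (intro sum.cong) (auto simp: entry algebra_simps)
    also have "\<dots> = \<alpha> * real (out_degree (with_proj G) (vs ! i)) * x (vs ! i)
        + (1 - \<alpha>) * (\<Sum>j<n. if (vs ! i, vs ! j) \<in> parcs G then x (vs ! j) else 0)"
      using i by (simp add: sum.distrib sum_distrib_left)
    also have "(\<Sum>j<n. if (vs ! i, vs ! j) \<in> parcs G then x (vs ! j) else 0)
        = (\<Sum>w\<in>pverts G. if (vs ! i, w) \<in> parcs G then x w else 0)"
      using sum.reindex_bij_betw[OF bij] .
    also have "\<dots> = (\<Sum>w \<in> {w \<in> pverts G. (vs ! i, w) \<in> parcs G}. x w)"
      using assms by (simp add: sum.inter_filter)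
    finally show ?thesis .
  qed
  have vert: "pverts G = (!) vs ` {..<n}"
    using bij by (simp add: bij_betw_def)
  have all_vert: "(\<forall>v \<in> pverts G. Q v) \<longleftrightarrow> (\<forall>i<n. Q (vs ! i))" for Q
    unfolding vert by (simp only: ball_simps) (simp only: Ball_def lessThan_iff)
  have ex_vert: "(\<exists>v \<in> pverts G. Q v) \<longleftrightarrow> (\<exists>i<n. Q (vs ! i))" for Q
    unfolding vert by (simp only: bex_simps) (simp only: Bex_def lessThan_iff)
  have ev: "eigenvector (A_alpha \<alpha> G) y k \<longleftrightarrow> ?P x"
    if y: "y \<in> carrier_vec n" "\<And>j. j < n \<Longrightarrow> y $ j = x (vs ! j)" for x y
  proof -
    have "dim_vec y = n" using y(1) by auto
    have "A_alpha \<alpha> G *\<^sub>v y = k \<cdot>\<^sub>v y \<longleftrightarrow> (\<forall>i<n. (A_alpha \<alpha> G *\<^sub>v y) $ i = k * y $ i)"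
      using \<open>dim_vec y = n\<close> dim by (auto simp: vec_eq_iff simp del: index_mult_mat_vec)
    also have "\<dots> \<longleftrightarrow> (\<forall>i<n. \<alpha> * real (out_degree (with_proj G) (vs ! i)) * x (vs ! i)
        + (1 - \<alpha>) * (\<Sum>w \<in> {w \<in> pverts G. (vs ! i, w) \<in> parcs G}. x w) = k * x (vs ! i))"
      using mult[OF _ y] y(2) by (metis (no_types, lifting))
    finally have 1: "A_alpha \<alpha> G *\<^sub>v y = k \<cdot>\<^sub>v y \<longleftrightarrow> \<dots>" .
    have "y \<noteq> 0\<^sub>v n \<longleftrightarrow> (\<exists>i<n. y $ i \<noteq> 0)"
      using \<open>dim_vec y = n\<close> by (auto simp: vec_eq_iff)
    also have "\<dots> \<longleftrightarrow> (\<exists>i<n. x (vs ! i) \<noteq> 0)"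
      using y(2) by metis
    finally have 2: "y \<noteq> 0\<^sub>v n \<longleftrightarrow> \<dots>" .
    have "?P x \<longleftrightarrow> (\<exists>i<n. x (vs ! i) \<noteq> 0) \<and>
        (\<forall>i<n. \<alpha> * real (out_degree (with_proj G) (vs ! i)) * x (vs ! i)
        + (1 - \<alpha>) * (\<Sum>w \<in> {w \<in> pverts G. (vs ! i, w) \<in> parcs G}. x w) = k * x (vs ! i))"
      unfolding all_vert ex_vert by (rule refl)
    then show ?thesis
      unfolding eigenvector_def dim using y(1) 1 2 by blast
  qed
  show ?thesis
  proof
    assume "eigenvalue (A_alpha \<alpha> G) k"
    then obtain y where e: "eigenvector (A_alpha \<alpha> G) y k" by (auto simp: eigenvalue_def)
    then have y: "y \<in> carrier_vec n" by (auto simp: eigenvector_def dim)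
    define x where "x = (\<lambda>v. y $ (inv_into {..<n} ((!) vs) v))"
    have "y $ j = x (vs ! j)" if "j < n" for j
      using that bij by (simp add: x_def bij_betw_def inv_into_f_f)
    with e have "?P x" using ev[OF y, of x] by simp
    then show "\<exists>x. ?P x" by (intro exI[of _ x])
  next
    assume "\<exists>x. ?P x"
    then obtain x where "?P x" by (rule exE)
    then have "eigenvector (A_alpha \<alpha> G) (vec n (\<lambda>j. x (vs ! j))) k"
      using ev[of "vec n (\<lambda>j. x (vs ! j))" x] by simp
    then show "eigenvalue (A_alpha \<alpha> G) k" by (auto simp: eigenvalue_def)
  qed
qed

end

theory Submission
  imports Defs "HOL-Analysis.Function_Topology"
begin

text \<open>
  Let \<open>k\<close> be the largest eigenvalue for \<open>G\<^sub>u(p + 1, q - 1)\<close>, with positive eigenvector \<open>x\<close>. Along a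
  pendant path, \<open>x\<close> is a multiple of the solution \<open>F\<close> of a two-term linear recurrence started at
  the free end. Keep \<open>x\<close> on \<open>G\<close> and put on the two paths of \<open>G\<^sub>u(p, q)\<close> the multiples of \<open>F\<close> that agree
  with \<open>x\<close> at \<open>u\<close>. The result is positive and satisfies the eigenvalue equation for \<open>k\<close> everywhere
  except at \<open>u\<close>, where the left-hand side is too large if and only if
  \<open>F (p + 1) / F (p + 2) + F (q - 1) / F q < F p / F (p + 1) + F q / F (q + 1)\<close>; in that case
  Rayleigh's principle gives the strict inequality.

  The difference \<open>F (n + 1) / F (n + 2) - F n / F (n + 1)\<close> is a positive constant divided by
  \<open>F (n + 1) * F (n + 2)\<close>, so the condition is \<open>F q * F (q + 1) < F (p + 1) * F (p + 2)\<close>. The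
  eigenvalue equation of \<open>x\<close> at \<open>u\<close>, where \<open>G\<close> contributes a positive amount, says
  \<open>F (p + 1) * F q < F (p + 2) * F (q + 1)\<close>. As \<open>F (i + 1) * F (j + 1) - F i * F j\<close> depends only on
  \<open>i + j\<close>, the same inequality holds for all index pairs with sum \<open>p + q + 1\<close>, and multiplying these
  inequalities yields the condition.
\<close>

section \<open>Rayleigh's principle for nonnegative symmetric matrices\<close>

text \<open>For small \<open>t\<close> of sign opposite to \<open>g\<close> the linear term
  dominates and is negative. This serves as the first-order condition at a maximum of the Rayleigh
  quotient.\<close>

lemma nonneg_quadratic_linear_coeff_zero:
  fixes g k :: real
  assumes "\<And>t. 0 \<le> 2 * t * g + t\<^sup>2 * k"
  shows "g = 0"
proof (rule ccontr)
  assume "g \<noteq> 0"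
  define K where "K = \<bar>k\<bar> + 1"
  have K: "K > 0" "k < K" by (auto simp: K_def)
  have "0 \<le> 2 * (- g / K) * g + (- g / K)\<^sup>2 * k" by (rule assms)
  also have "\<dots> = g\<^sup>2 / K * (k / K - 2)"
    using K by (simp add: field_simps power2_eq_square)
  finally have "0 \<le> g\<^sup>2 / K * (k / K - 2)" .
  moreover have "g\<^sup>2 / K > 0" using \<open>g \<noteq> 0\<close> K by simp
  ultimately have "0 \<le> k / K - 2" by (metis mult_le_cancel_left_pos mult_zero_right)
  moreover have "k / K < 1" using K by simp
  ultimately show False by linarith
qed

text \<open>The quadratic form attains its maximum on the unit sphere. Passing to absolute values
  does not decrease it, since the entries of \<open>M\<close> are nonnegative, and a maximiser is an
  eigenvector because the derivative in each coordinate direction vanishes.\<close>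

lemma nonneg_symmetric_top_eigenvector:
  fixes M :: "'b \<Rightarrow> 'b \<Rightarrow> real"
  assumes fin: "finite V" and ne: "V \<noteq> {}"
    and sym: "\<And>v w. v \<in> V \<Longrightarrow> w \<in> V \<Longrightarrow> M v w = M w v"
    and nonneg: "\<And>v w. v \<in> V \<Longrightarrow> w \<in> V \<Longrightarrow> 0 \<le> M v w"
  obtains l x where "\<And>v. 0 \<le> x v" "\<exists>v\<in>V. x v \<noteq> 0"
    "\<And>v. v \<in> V \<Longrightarrow> (\<Sum>w\<in>V. M v w * x w) = l * x v"
    "\<And>y. (\<Sum>v\<in>V. y v * (\<Sum>w\<in>V. M v w * y w)) \<le> l * (\<Sum>v\<in>V. (y v)\<^sup>2)"
proof -
  define B where "B = (\<lambda>x y. \<Sum>v\<in>V. x v * (\<Sum>w\<in>V. M v w * y w))"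
  define N where "N = (\<lambda>y. \<Sum>v\<in>V. (y v :: real)\<^sup>2)"
  \<comment> \<open>Vectors are functions on the whole type; pinning the coordinates outside
    \<open>V\<close> to 0 gives a product of compact sets, hence a compact set.\<close>
  define box where "box = PiE UNIV (\<lambda>v. if v \<in> V then {-1..1::real} else {0})"
  define S where "S = box \<inter> {x. N x = 1}"
  have "compactin (product_topology (\<lambda>_::'b. euclidean) UNIV) box"
    unfolding box_def by (subst compactin_PiE) auto
  then have "compact box" by (simp add: euclidean_product_topology)
  have cN: "continuous_on UNIV N"
    unfolding N_def by (intro continuous_intros continuous_on_product_coordinates)
  have "closed {x. N x = 1}"
    using closed_vimage[of "{1}" N] cN by (auto simp: vimage_def)
  then have "compact S" unfolding S_def using \<open>compact box\<close> by (intro compact_Int_closed)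
  obtain v0 where v0: "v0 \<in> V" using ne by auto
  have "(\<lambda>v. if v = v0 then 1 else 0) \<in> S"
    using v0 fin by (auto simp: S_def box_def N_def if_distrib[of "\<lambda>t. t\<^sup>2"] cong: if_cong)
  then have "S \<noteq> {}" by auto
  have "continuous_on S (\<lambda>x. B x x)"
    unfolding B_def
    by (intro continuous_intros continuous_on_subset[OF continuous_on_product_coordinates]) auto
  then obtain x where x: "x \<in> S" "\<And>y. y \<in> S \<Longrightarrow> B y y \<le> B x x"
    using continuous_attains_sup[OF \<open>compact S\<close> \<open>S \<noteq> {}\<close>] by blast
  define l where "l = B x x"
  have N0: "N y \<ge> 0" for y by (auto simp: N_def intro: sum_nonneg)
  have ray: "B y y \<le> l * N y" for y
  proof (cases "N y = 0")
    case True
    then have "\<forall>v\<in>V. y v = 0" using fin by (auto simp: N_def sum_nonneg_eq_0_iff)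
    then show ?thesis using True by (simp add: B_def)
  next
    case False
    then have pos: "N y > 0" using N0[of y] by auto
    define s where "s = sqrt (N y)"
    have s: "s > 0" "s\<^sup>2 = N y" using pos by (auto simp: s_def)
    define z where "z = (\<lambda>v. if v \<in> V then y v / s else 0)"
    have Bz: "B z z = B y y / N y"
      unfolding B_def z_def s(2)[symmetric]
      by (simp add: sum_divide_distrib sum_distrib_left power2_eq_square)
    have Nz: "N z = 1"
      using s pos by (simp add: N_def z_def power_divide sum_divide_distrib[symmetric])
    have "z v \<in> {-1..1}" if "v \<in> V" for v
    proof -
      have "(z v)\<^sup>2 \<le> N z" unfolding N_def using fin that by (intro member_le_sum) auto
      then show ?thesis using Nz abs_square_le_1[of "z v"] by auto
    qed
    then have "z \<in> S" using Nz by (auto simp: S_def box_def z_def)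
    from x(2)[OF this] show ?thesis using pos by (simp add: Bz l_def divide_le_eq)
  qed
  define a where "a = (\<lambda>v. \<bar>x v\<bar>)"
  have Na: "N a = 1" using x(1) by (simp add: S_def N_def a_def)
  have "B x x \<le> B a a"
    unfolding B_def sum_distrib_left
  proof (intro sum_mono)
    fix v w assume vw: "v \<in> V" "w \<in> V"
    have "x v * (M v w * x w) \<le> \<bar>x v * (M v w * x w)\<bar>" by simp
    also have "\<dots> = a v * (M v w * a w)" using nonneg[OF vw] by (simp add: a_def abs_mult)
    finally show "x v * (M v w * x w) \<le> a v * (M v w * a w)" .
  qed
  then have Ba: "B a a = l" using ray[of a] Na by (simp add: l_def)
  have eig: "(\<Sum>w\<in>V. M v w * a w) = l * a v" if v: "v \<in> V" for v
  proof -
    define e where "e = (\<lambda>w. if w = v then 1 else 0 :: real)"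
    have Bsym: "B a e = B e a"
      unfolding B_def sum_distrib_left
      by (subst sum.swap) (auto intro!: sum.cong simp: sym)
    have Bea: "B e a = (\<Sum>w\<in>V. M v w * a w)"
      using v fin by (simp add: B_def e_def if_distrib[of "\<lambda>t. t * _"] cong: if_cong)
    \<comment> \<open>The right-hand side is \<open>l * N y - B y y\<close> for
      \<open>y = a + t * e\<close>; its constant term vanishes because \<open>B a a = l\<close> and
      \<open>N a = 1\<close>.\<close>
    have "0 \<le> 2 * t * (l * a v - B e a) + t\<^sup>2 * (l - B e e)" for t
    proof -
      define y where "y = (\<lambda>w. a w + t * e w)"
      have 1: "B y y = B a a + t * B a e + t * B e a + t\<^sup>2 * B e e"
        unfolding B_def y_def
        by (simp add: algebra_simps sum.distrib sum_distrib_left power2_eq_square)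
      have ae: "(\<Sum>w\<in>V. a w * e w) = a v" "(\<Sum>w\<in>V. (e w)\<^sup>2) = 1"
        using v fin by (simp_all add: e_def if_distrib[of "\<lambda>t. t\<^sup>2"] if_distrib[of "\<lambda>t. _ * t"] cong: if_cong)
      have "N y = N a + 2 * t * (\<Sum>w\<in>V. a w * e w) + t\<^sup>2 * (\<Sum>w\<in>V. (e w)\<^sup>2)"
        unfolding N_def y_def
        by (simp add: algebra_simps sum.distrib sum_distrib_left power2_eq_square)
      then have 2: "N y = 1 + 2 * t * a v + t\<^sup>2" using ae Na by simp
      show ?thesis using ray[of y] unfolding 1 2 Bsym Ba by (simp add: algebra_simps)
    qed
    then have "l * a v - B e a = 0" by (rule nonneg_quadratic_linear_coeff_zero)
    then show ?thesis by (simp add: Bea)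
  qed
  have "\<exists>v\<in>V. a v \<noteq> 0"
  proof (rule ccontr)
    assume "\<not> ?thesis"
    then have "N a = 0" by (simp add: N_def)
    then show False using Na by simp
  qed
  then show thesis
    using that[of a l] eig ray by (auto simp: a_def B_def N_def)
qed

section \<open>Inequalities for two-term linear recurrences\<close>

text \<open>Both sides expand to \<open>c * F (Suc m) * F (Suc n) - F m * F (Suc n) - F (Suc m) * F
  n\<close>. An index step can thus be moved from one factor to the other.\<close>

lemma linear_recurrence_shift:
  fixes F :: "nat \<Rightarrow> 'a :: comm_ring"
  assumes rec: "\<And>n. F (Suc (Suc n)) = c * F (Suc n) - F n"
  shows "F (Suc (Suc m)) * F (Suc n) - F (Suc m) * F n = F (Suc m) * F (Suc (Suc n)) - F m * F (Suc n)"
  unfolding rec[of m] rec[of n] by (simp add: algebra_simps)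

text \<open>The induction moves both indices inwards, from \<open>(p, q)\<close> to
  \<open>(p - 1, q + 1)\<close>. The gap shrinks by 2, hence two base cases; for
  \<open>p = q\<close> the claim is the last hypothesis with its factors commuted.\<close>

lemma linear_recurrence_product_less:
  fixes F :: "nat \<Rightarrow> real"
  assumes rec: "\<And>n. F (Suc (Suc n)) = c * F (Suc n) - F n"
    and pos: "\<And>i. 1 \<le> i \<Longrightarrow> i \<le> p + 2 \<Longrightarrow> 0 < F i"
    and "1 \<le> q" "q \<le> p"
    and "F (p + 1) * F q < F (p + 2) * F (q + 1)"
  shows "F q * F (q + 1) < F (p + 1) * F (p + 2)"
  using assms(2-)
proof (induction "p - q" arbitrary: p q rule: less_induct)
  case less
  note pos = less.prems(1)
  consider "p = q" | "p = q + 1" | "q + 2 \<le> p" using less.prems(3) by linarith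
  then show ?case
  proof cases
    case 1
    then show ?thesis using less.prems(4) pos[of "q+1"] pos[of q] less.prems(2)
      by (simp add: mult.commute)
  next
    case 2
    \<comment> \<open>The shift turns the hypothesis into an inequality between two squares, so
      \<open>F\<close> increases from \<open>q + 1\<close> to \<open>q + 2\<close>.\<close>
    have s: "F (q + 2) * F (q + 2) - F (q + 1) * F (q + 1) = F (q + 3) * F (q + 1) - F (q + 2) * F q"
      using linear_recurrence_shift[of F c, OF rec, of "q + 1" q] by (simp add: numeral_3_eq_3)
    have p: "F q > 0" "F (q+1) > 0" "F (q+2) > 0" "F (q+3) > 0"
      using 2 less.prems(2) by (auto intro!: pos)
    have "F (q + 2) * F q < F (q + 3) * F (q + 1)" using less.prems(4) 2 by (simp add: numeral_3_eq_3)
    moreover from this s have "F (q + 1) * F (q + 1) < F (q + 2) * F (q + 2)" by linarith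
    then have "F (q + 1) < F (q + 2)" using p
      by (simp add: power2_eq_square[symmetric] power_less_imp_less_base)
    ultimately have "F (q + 2) * F q < F (q + 3) * F (q + 2)"
      using p by (smt (verit) mult_strict_left_mono)
    then have "F q < F (q + 3)" using p(3) by (simp add: mult.commute)
    then have "F q * F (q+1) < F (q+3) * F (q+2)" using \<open>F (q + 1) < F (q + 2)\<close> p
      by (intro mult_strict_mono) auto
    then show ?thesis using 2 by (simp add: numeral_3_eq_3 mult.commute)
  next
    case 3
    then obtain r where r: "p = Suc r" by (cases p) auto
    \<comment> \<open>The shift preserves the difference of the two sides, so the hypothesis passes
      to the inner pair \<open>(r, q + 1)\<close>.\<close>
    have inner: "F (r + 1) * F (q + 1) < F (r + 2) * F (q + 2)"
      using less.prems(4) linear_recurrence_shift[of F c, OF rec, of "r + 1" q] r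
      by (simp add: mult.commute)
    have "F (q + 1) * F (q + 1 + 1) < F (r + 1) * F (r + 2)"
      using inner 3 r by (intro less.hyps) (auto intro!: pos)
    moreover have p: "F q > 0" "F (q+1) > 0" "F (q+2) > 0" "F (r + 1) > 0" "F (r+2) > 0" "F (r+3) > 0"
      using 3 r less.prems(2) by (auto intro!: pos)
    ultimately have A: "F (q + 1) * F (q + 2) < F (r + 1) * F (r + 2)" by simp
    have C: "F (r + 2) * F q < F (r + 3) * F (q + 1)" using less.prems(4) r by (simp add: numeral_3_eq_3)
    \<comment> \<open>Multiplying the outer and inner inequalities and cancelling leaves a bound
      whose product with \<open>A\<close> gives the claim after a second cancellation.\<close>
    have "(F (r + 2) * F q) * (F (r + 1) * F (q + 1)) < (F (r + 3) * F (q + 1)) * (F (r + 2) * F (q + 2))"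
      by (rule mult_strict_mono) (use inner C p in auto)
    then have "(F (r + 2) * F (q + 1)) * (F (r + 1) * F q) < (F (r + 2) * F (q + 1)) * (F (r + 3) * F (q + 2))"
      by (simp add: mult_ac)
    then have "F (r + 1) * F q < F (r + 3) * F (q + 2)"
      using p by (simp add: mult_less_cancel_left_pos)
    then have "(F (r + 1) * F q) * (F (q + 1) * F (q + 2)) < (F (r + 3) * F (q + 2)) * (F (r + 1) * F (r + 2))"
      by (rule mult_strict_mono) (use A p in auto)
    then have "(F (r + 1) * F (q + 2)) * (F q * F (q + 1)) < (F (r + 1) * F (q + 2)) * (F (r + 2) * F (r + 3))"
      by (simp add: mult_ac)
    then have "F q * F (q + 1) < F (r + 2) * F (r + 3)" using p by (simp add: mult_less_cancel_left_pos)
    then show ?thesis using r by (simp add: numeral_3_eq_3)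
  qed
qed

text \<open>The claim compares two increments of \<open>F n / F (n + 1)\<close>: the one from
  \<open>p\<close> to \<open>p + 1\<close> is smaller than the one from \<open>q - 1\<close> to
  \<open>q\<close>.\<close>

lemma linear_recurrence_ratio_less:
  fixes F :: "nat \<Rightarrow> real"
  assumes rec: "\<And>n. F (Suc (Suc n)) = c * F (Suc n) - F n"
    and "F 0 \<le> 0"
    and pos: "\<And>i. 1 \<le> i \<Longrightarrow> i \<le> p + 2 \<Longrightarrow> 0 < F i"
    and q: "1 \<le> q" "q \<le> p"
    and "F (p + 1) * F q < F (p + 2) * F (q + 1)"
  shows "F (p + 1) / F (p + 2) + F (q - 1) / F q < F p / F (p + 1) + F q / F (q + 1)"
proof -
  \<comment> \<open>The invariant of Cassini's identity; \<open>F 0 \<le> 0\<close> makes it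
    positive.\<close>
  define K where "K = (F 1)\<^sup>2 - F 2 * F 0"
  have cas: "(F (Suc n))\<^sup>2 - F (Suc (Suc n)) * F n = K" for n
  proof (induction n)
    case 0
    then show ?case by (simp add: K_def numeral_2_eq_2)
  next
    case (Suc n)
    then show ?case
      using linear_recurrence_shift[of F c, OF rec, of "Suc n" n] by (simp add: power2_eq_square)
  qed
  have "F 2 > 0" "F 1 > 0" by (auto intro!: pos)
  then have "K > 0" using \<open>F 0 \<le> 0\<close> unfolding K_def
    by (smt (verit) mult_nonneg_nonpos zero_less_power)
  have step: "F (Suc n) / F (Suc (Suc n)) - F n / F (Suc n) = K / (F (Suc n) * F (Suc (Suc n)))"
    if "Suc n \<le> p + 1" for n
  proof -
    have "F (Suc n) > 0" "F (Suc (Suc n)) > 0" using that by (auto intro!: pos)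
    then show ?thesis unfolding cas[of n, symmetric] by (simp add: field_simps power2_eq_square)
  qed
  have less: "F q * F (q + 1) < F (p + 1) * F (p + 2)"
    by (rule linear_recurrence_product_less[OF rec pos q assms(6)])
  have "F q * F (q + 1) > 0" using q by (auto intro!: mult_pos_pos pos)
  then have "K / (F (p + 1) * F (p + 2)) < K / (F q * F (q + 1))"
    using less \<open>K > 0\<close> by (intro divide_strict_left_mono) auto
  moreover have "F (p + 1) / F (p + 2) - F p / F (p + 1) = K / (F (p + 1) * F (p + 2))"
    using step[of p] by simp
  moreover have "F q / F (q + 1) - F (q - 1) / F q = K / (F q * F (q + 1))"
    using step[of "q - 1"] q by simp
  ultimately show ?thesis by linarith
qed

section \<open>The matrix as an operator, and its largest eigenvalue\<close>

text \<open>The degree is distributed over the neighbours, so that attaching an edge at a vertex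
  adds one summand there.\<close>

definition A_alpha_op :: "real \<Rightarrow> 'a pair_pre_digraph \<Rightarrow> ('a \<Rightarrow> real) \<Rightarrow> 'a \<Rightarrow> real" where
  "A_alpha_op \<alpha> G x v = (\<Sum>w | (v, w) \<in> parcs G. \<alpha> * x v + (1 - \<alpha>) * x w)"

context pair_graph
begin

lemma arc_in_verts: "(v, w) \<in> parcs G \<Longrightarrow> v \<in> pverts G \<and> w \<in> pverts G"
  using arc_fst_in_verts[of "(v, w)"] arc_snd_in_verts[of "(v, w)"] by auto

lemma arc_sym: "(v, w) \<in> parcs G \<Longrightarrow> (w, v) \<in> parcs G"
  using pair_sym_arcs by (auto simp: symmetric_def sym_def)

lemma finite_neighbours: "finite {w. (v, w) \<in> parcs G}"
  by (rule finite_subset[OF _ pair_finite_verts]) (auto dest: arc_in_verts)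

lemma out_degree_eq_card_neighbours:
  "out_degree (with_proj G) v = card {w. (v, w) \<in> parcs G}"
proof -
  have "out_arcs (with_proj G) v = Pair v ` {w. (v, w) \<in> parcs G}"
    by (auto simp: out_arcs_def)
  then show ?thesis by (simp add: out_degree_def card_image inj_on_def)
qed

lemma A_alpha_op_eq:
  "A_alpha_op \<alpha> G x v = \<alpha> * real (out_degree (with_proj G) v) * x v
     + (1 - \<alpha>) * (\<Sum>w \<in> {w \<in> pverts G. (v, w) \<in> parcs G}. x w)"
proof -
  have "{w \<in> pverts G. (v, w) \<in> parcs G} = {w. (v, w) \<in> parcs G}"
    by (auto dest: arc_in_verts)
  then show ?thesis
    by (simp add: A_alpha_op_def out_degree_eq_card_neighbours sum.distrib sum_distrib_left)
qed

text \<open>The maximum of the Rayleigh quotient is an eigenvalue, and testing the quotient on any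
  other eigenvector shows that no eigenvalue exceeds it.\<close>

lemma rho_top_eigenvector:
  assumes "0 \<le> \<alpha>" "\<alpha> < 1" "pverts G \<noteq> {}"
  obtains x where "\<And>v. 0 \<le> x v" "\<exists>v\<in>pverts G. x v \<noteq> 0"
    "\<And>v. v \<in> pverts G \<Longrightarrow> A_alpha_op \<alpha> G x v = rho \<alpha> G * x v"
    "\<And>y. (\<Sum>v\<in>pverts G. y v * A_alpha_op \<alpha> G y v) \<le> rho \<alpha> G * (\<Sum>v\<in>pverts G. (y v)\<^sup>2)"
proof -
  define M where "M = (\<lambda>v w. (if v = w then \<alpha> * real (out_degree (with_proj G) v) else 0)
      + (1 - \<alpha>) * (if (v, w) \<in> parcs G then 1 else 0))"
  have op: "(\<Sum>w\<in>pverts G. M v w * x w) = A_alpha_op \<alpha> G x v" if "v \<in> pverts G" for v x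
  proof -
    have "(\<Sum>w\<in>pverts G. M v w * x w) =
        (\<Sum>w\<in>pverts G. (if v = w then \<alpha> * real (out_degree (with_proj G) v) * x w else 0)
           + (1 - \<alpha>) * (if (v, w) \<in> parcs G then x w else 0))"
      by (intro sum.cong) (auto simp: M_def algebra_simps)
    also have "\<dots> = A_alpha_op \<alpha> G x v"
      using that pair_finite_verts
      by (simp add: A_alpha_op_eq sum.distrib sum_distrib_left[symmetric] sum.inter_filter)
    finally show ?thesis .
  qed
  obtain l x where x: "\<And>v. 0 \<le> x v" "\<exists>v\<in>pverts G. x v \<noteq> 0"
    "\<And>v. v \<in> pverts G \<Longrightarrow> (\<Sum>w\<in>pverts G. M v w * x w) = l * x v"
    "\<And>y. (\<Sum>v\<in>pverts G. y v * (\<Sum>w\<in>pverts G. M v w * y w)) \<le> l * (\<Sum>v\<in>pverts G. (y v)\<^sup>2)"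
    using assms arc_sym
    by (rule_tac nonneg_symmetric_top_eigenvector[OF pair_finite_verts assms(3), of M])
      (auto simp: M_def)
  have ray: "(\<Sum>v\<in>pverts G. y v * A_alpha_op \<alpha> G y v) \<le> l * (\<Sum>v\<in>pverts G. (y v)\<^sup>2)" for y
    using x(4)[of y] by (simp add: op)
  have eigI: "eigenvalue (A_alpha \<alpha> G) k \<longleftrightarrow>
      (\<exists>y. (\<exists>v\<in>pverts G. y v \<noteq> 0) \<and> (\<forall>v\<in>pverts G. A_alpha_op \<alpha> G y v = k * y v))" for k
    unfolding eigenvalue_A_alpha_iff[OF pair_finite_verts] A_alpha_op_eq ..
  have "eigenvalue (A_alpha \<alpha> G) l" unfolding eigI using x(2,3) op by auto
  moreover have "k \<le> l" if "eigenvalue (A_alpha \<alpha> G) k" for k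
  proof -
    from that obtain y where y: "\<exists>v\<in>pverts G. y v \<noteq> 0"
      "\<And>v. v \<in> pverts G \<Longrightarrow> A_alpha_op \<alpha> G y v = k * y v" unfolding eigI by auto
    have "k * (\<Sum>v\<in>pverts G. (y v)\<^sup>2) = (\<Sum>v\<in>pverts G. y v * A_alpha_op \<alpha> G y v)"
      by (simp add: y(2) sum_distrib_left power2_eq_square mult_ac)
    also have "\<dots> \<le> l * (\<Sum>v\<in>pverts G. (y v)\<^sup>2)" by (rule ray)
    finally have "k * (\<Sum>v\<in>pverts G. (y v)\<^sup>2) \<le> l * (\<Sum>v\<in>pverts G. (y v)\<^sup>2)" .
    moreover have "(\<Sum>v\<in>pverts G. (y v)\<^sup>2) > 0"
      using y(1) pair_finite_verts by (auto intro: sum_pos2)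
    ultimately show ?thesis by simp
  qed
  \<comment> \<open>\<open>rho\<close> is a \<open>Max\<close>, which is meaningful only on a finite
    set; the eigenvalues are roots of the characteristic polynomial.\<close>
  moreover have "finite {k. eigenvalue (A_alpha \<alpha> G) k}"
  proof -
    have A: "A_alpha \<alpha> G \<in> carrier_mat (length (vertex_list G)) (length (vertex_list G))"
      by (auto simp: A_alpha_def deg_matrix_def adj_matrix_def Let_def)
    have "char_poly (A_alpha \<alpha> G) \<noteq> 0" using degree_monic_char_poly[OF A] by auto
    then show ?thesis unfolding eigenvalue_root_char_poly[OF A] by (rule poly_roots_finite)
  qed
  ultimately have "rho \<alpha> G = l" unfolding rho_def by (intro Max_eqI) auto
  then show thesis using that[of x] x op ray by auto
qed

text \<open>Here \<open>y\<close> is a test vector for Rayleigh's principle: weighting the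
  inequalities by \<open>y\<close> and summing keeps the strictness at \<open>u\<close>, as
  \<open>y u\<close> is positive.\<close>

lemma less_rho_if_subinvariant:
  assumes "0 \<le> \<alpha>" "\<alpha> < 1"
    and "\<And>v. v \<in> pverts G \<Longrightarrow> 0 \<le> y v"
    and "\<And>v. v \<in> pverts G \<Longrightarrow> k * y v \<le> A_alpha_op \<alpha> G y v"
    and "u \<in> pverts G" "0 < y u" "k * y u < A_alpha_op \<alpha> G y u"
  shows "k < rho \<alpha> G"
proof -
  have ray: "(\<Sum>v\<in>pverts G. y v * A_alpha_op \<alpha> G y v) \<le> rho \<alpha> G * (\<Sum>v\<in>pverts G. (y v)\<^sup>2)"
    using rho_top_eigenvector[OF assms(1,2)] assms(5) by (metis empty_iff)
  have "k * (\<Sum>v\<in>pverts G. (y v)\<^sup>2) = (\<Sum>v\<in>pverts G. y v * (k * y v))"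
    by (simp add: sum_distrib_left power2_eq_square mult_ac)
  also have "\<dots> < (\<Sum>v\<in>pverts G. y v * A_alpha_op \<alpha> G y v)"
    using assms pair_finite_verts
    by (intro sum_strict_mono_ex1) (auto intro!: mult_left_mono bexI[of _ u])
  also note ray
  finally have "k * (\<Sum>v\<in>pverts G. (y v)\<^sup>2) < rho \<alpha> G * (\<Sum>v\<in>pverts G. (y v)\<^sup>2)" .
  moreover have "(\<Sum>v\<in>pverts G. (y v)\<^sup>2) \<ge> 0" by (intro sum_nonneg) auto
  ultimately show ?thesis by (simp add: mult_less_cancel_right)
qed

end

section \<open>Connectedness and positivity of eigenvectors\<close>

text \<open>Phrased with the plain closure of the arc relation, so that induction along walks is
  \<open>rtrancl\<close> induction.\<close>

definition linked :: "'a pair_pre_digraph \<Rightarrow> bool" where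
  "linked G \<longleftrightarrow> (\<forall>v\<in>pverts G. \<forall>w\<in>pverts G. (v, w) \<in> (parcs G)\<^sup>*)"

lemma linked_if_connected:
  assumes "pair_graph G" "Digraph_Component.connected (with_proj G)"
  shows "linked G"
proof -
  interpret pair_graph G by fact
  have "strongly_connected (with_proj G)"
    using symmetric_connected_imp_strongly_connected assms(2) pair_sym_arcs by auto
  then show ?thesis
    using reachable_rtranclI[of "with_proj G"]
    by (auto simp: linked_def strongly_connected_def)
qed

text \<open>Every vertex is reachable from \<open>Inl u\<close>, inside \<open>G\<close> or along
  the path; by symmetry any two vertices are joined through \<open>Inl u\<close>.\<close>

lemma linked_attach_path:
  assumes "pair_graph G" "linked G" "u \<in> pverts G"
  shows "linked (attach_path G u p)"
proof -
  interpret H: pair_graph "attach_path G u p" using assms by (intro pair_graph_attach_path)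
  let ?R = "(parcs (attach_path G u p))\<^sup>*"
  have inl: "(Inl v, Inl w) \<in> ?R" if "(v, w) \<in> (parcs G)\<^sup>*" for v w
    using that
  proof induction
    case (step a b)
    then have "(Inl a, Inl b) \<in> parcs (attach_path G u p)"
      by (force simp: attach_path_def)
    with step show ?case by (meson rtrancl.simps)
  qed simp
  have path: "(Inl u, path_vertex u i) \<in> ?R" if "i \<le> p" for i
    using that
  proof (induction i)
    case 0
    then show ?case by (simp add: path_vertex_def)
  next
    case (Suc i)
    then have "(path_vertex u i, path_vertex u (Suc i)) \<in> parcs (attach_path G u p)"
      by (force simp: attach_path_def)
    with Suc show ?case by (meson Suc_leD rtrancl.simps)
  qed
  have from_u: "(Inl u, v) \<in> ?R" if "v \<in> pverts (attach_path G u p)" for v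
  proof (cases v)
    case (Inl a)
    then have "a \<in> pverts G" using that by (auto simp: attach_path_def)
    then show ?thesis using Inl assms by (auto simp: linked_def intro: inl)
  next
    case (Inr i)
    then show ?thesis using that path[of i] by (auto simp: attach_path_def path_vertex_def)
  qed
  have "sym ?R" using H.arc_sym by (intro sym_rtrancl symI)
  then show ?thesis using from_u unfolding linked_def by (meson rtrancl_trans symE)
qed

text \<open>Zeros spread: where \<open>x\<close> vanishes, the eigenvalue equation makes a sum of
  nonnegative neighbour terms vanish, so \<open>x\<close> is zero at all neighbours and finally
  everywhere.\<close>

lemma (in pair_graph) eigenvector_pos_if_linked:
  assumes "linked G" "\<alpha> < 1" "\<And>v. 0 \<le> x v" "\<exists>v\<in>pverts G. x v \<noteq> 0"
    "\<And>v. v \<in> pverts G \<Longrightarrow> A_alpha_op \<alpha> G x v = k * x v"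
    and v: "v \<in> pverts G"
  shows "0 < x v"
proof (rule ccontr)
  assume "\<not> 0 < x v"
  then have "x v = 0" using assms(3)[of v] by simp
  have "x w = 0" if "(v, w) \<in> (parcs G)\<^sup>*" for w
    using that
  proof induction
    case (step a b)
    have "(\<Sum>w | (a, w) \<in> parcs G. (1 - \<alpha>) * x w) = 0"
      using assms(5)[of a] step arc_in_verts[of a b] by (simp add: A_alpha_op_def)
    then have "(1 - \<alpha>) * x b = 0"
      using step(2) assms(2,3) finite_neighbours by (subst (asm) sum_nonneg_eq_0_iff) auto
    then show ?case using assms(2) by simp
  qed fact
  then show False using assms(1,4) v by (auto simp: linked_def)
qed

section \<open>Eigenvectors along pendant paths\<close>

lemma A_alpha_op_attach_path_Inl:
  assumes "pair_graph G"
  shows "A_alpha_op \<alpha> (attach_path G u p) x (Inl v) = A_alpha_op \<alpha> G (x \<circ> Inl) v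
    + (if v = u \<and> 1 \<le> p then \<alpha> * x (Inl u) + (1 - \<alpha>) * x (Inr 1) else 0)"
proof -
  interpret pair_graph G by fact
  have nb: "{w. (Inl v, w) \<in> parcs (attach_path G u p)} =
      Inl ` {w. (v, w) \<in> parcs G} \<union> (if v = u \<and> 1 \<le> p then {Inr 1} else {})"
    by (auto simp: attach_path_def path_vertex_def)
  show ?thesis
    unfolding A_alpha_op_def nb
    by (subst sum.union_disjoint) (auto simp: sum.reindex finite_neighbours)
qed

lemma A_alpha_op_attach_path_Inr:
  assumes "1 \<le> i" "i \<le> p"
  shows "A_alpha_op \<alpha> (attach_path G u p) x (Inr i) =
    \<alpha> * x (Inr i) + (1 - \<alpha>) * x (path_vertex u (i - 1))
    + (if i < p then \<alpha> * x (Inr i) + (1 - \<alpha>) * x (path_vertex u (i + 1)) else 0)"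
proof -
  have nb: "{w. (Inr i, w) \<in> parcs (attach_path G u p)} =
      insert (path_vertex u (i - 1)) (if i < p then {path_vertex u (i + 1)} else {})"
  proof -
    have "(Inr i, w) \<in> parcs (attach_path G u p) \<longleftrightarrow>
        w = path_vertex u (i - 1) \<or> i < p \<and> w = path_vertex u (i + 1)" for w
      using assms by (cases i) (auto simp: attach_path_def path_vertex_def split: if_splits)
    then show ?thesis by auto
  qed
  show ?thesis
    unfolding A_alpha_op_def nb by (auto simp: path_vertex_def)
qed

text \<open>An eigenvector is determined on a pendant path, up to scaling, by starting at the free end:
  \<open>path_seq \<alpha> c (Suc j)\<close> is its value at distance \<open>j\<close> from that end. The value \<open>- \<alpha>\<close> at index \<open>0\<close>
  is that of a fictitious vertex beyond the end, chosen such that the equation at the end vertex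
  takes the same form as at the inner vertices.\<close>

fun path_seq :: "real \<Rightarrow> real \<Rightarrow> nat \<Rightarrow> real" where
  "path_seq \<alpha> c 0 = - \<alpha>"
| "path_seq \<alpha> c (Suc 0) = 1 - \<alpha>"
| "path_seq \<alpha> c (Suc (Suc n)) = c * path_seq \<alpha> c (Suc n) - path_seq \<alpha> c n"

text \<open>\<open>A_alpha_op\<close> at distance \<open>i\<close> from the root of a pendant path
  of length \<open>m\<close>. Index 0 is the root itself, so only \<open>1 \<le> i\<close> and
  \<open>i \<le> m\<close> are meaningful.\<close>

definition path_op :: "real \<Rightarrow> nat \<Rightarrow> (nat \<Rightarrow> real) \<Rightarrow> nat \<Rightarrow> real" where
  "path_op \<alpha> m a i = \<alpha> * a i + (1 - \<alpha>) * a (i - 1)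
     + (if i < m then \<alpha> * a i + (1 - \<alpha>) * a (i + 1) else 0)"

text \<open>The multiplier \<open>(k - 2 * \<alpha>) / (1 - \<alpha>)\<close> comes from solving the
  eigenvalue equation at a vertex of degree 2 for the neighbour nearer to the root.\<close>

lemma path_op_path_seq:
  assumes "\<alpha> < 1" "1 \<le> i" "i \<le> m"
  shows "path_op \<alpha> m (\<lambda>i. t * path_seq \<alpha> ((k - 2 * \<alpha>) / (1 - \<alpha>)) (Suc (m - i))) i
    = k * (t * path_seq \<alpha> ((k - 2 * \<alpha>) / (1 - \<alpha>)) (Suc (m - i)))"
proof -
  define F where "F = path_seq \<alpha> ((k - 2 * \<alpha>) / (1 - \<alpha>))"
  have rec: "(1 - \<alpha>) * F (Suc (Suc n)) = (k - 2 * \<alpha>) * F (Suc n) - (1 - \<alpha>) * F n" for n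
    using assms(1) by (simp add: F_def field_simps)
  have prev: "Suc (m - (i - 1)) = Suc (Suc (m - i))" using assms by simp
  show ?thesis
  proof (cases "i < m")
    case True
    then have "path_op \<alpha> m (\<lambda>i. t * F (Suc (m - i))) i = t * (2 * \<alpha> * F (Suc (m - i))
        + ((1 - \<alpha>) * F (Suc (Suc (m - i))) + (1 - \<alpha>) * F (m - i)))"
      unfolding path_op_def prev by (simp add: algebra_simps Suc_diff_Suc)
    then show ?thesis unfolding rec F_def[symmetric] by (simp add: algebra_simps)
  next
    \<comment> \<open>At the free end the missing neighbour would contribute
      \<open>\<alpha> * F 1 + (1 - \<alpha>) * F 0\<close>, which is 0.\<close>
    case False
    then have "m - i = 0" by simp
    have init: "F 0 = - \<alpha>" "F (Suc 0) = 1 - \<alpha>" by (simp_all add: F_def)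
    have "(1 - \<alpha>) * F (Suc (Suc 0)) = (k - \<alpha>) * F (Suc 0)"
      unfolding rec init by (simp add: algebra_simps)
    moreover have "path_op \<alpha> m (\<lambda>i. t * F (Suc (m - i))) i
        = t * (\<alpha> * F (Suc 0) + (1 - \<alpha>) * F (Suc (Suc 0)))"
      using False unfolding path_op_def prev \<open>m - i = 0\<close> by (simp add: algebra_simps)
    ultimately show ?thesis
      unfolding F_def[symmetric] \<open>m - i = 0\<close> by (simp add: algebra_simps)
  qed
qed

text \<open>The equations determine the values from the free end towards the root. The factor
  \<open>1 - \<alpha>\<close> on the left is the value of \<open>path_seq\<close> at the free
  end.\<close>

lemma path_eigenvector_eq_path_seq:
  assumes "\<alpha> < 1" and eig: "\<And>i. 1 \<le> i \<Longrightarrow> i \<le> m \<Longrightarrow> path_op \<alpha> m a i = k * a i"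
    and "j \<le> m"
  shows "(1 - \<alpha>) * a (m - j) = a m * path_seq \<alpha> ((k - 2 * \<alpha>) / (1 - \<alpha>)) (Suc j)"
  using \<open>j \<le> m\<close>
proof (induction j rule: less_induct)
  case (less j)
  define F where "F = path_seq \<alpha> ((k - 2 * \<alpha>) / (1 - \<alpha>))"
  have rec: "(1 - \<alpha>) * F (Suc (Suc n)) = (k - 2 * \<alpha>) * F (Suc n) - (1 - \<alpha>) * F n" for n
    using assms(1) by (simp add: F_def field_simps)
  have init: "F 0 = - \<alpha>" "F (Suc 0) = 1 - \<alpha>" by (simp_all add: F_def)
  consider "j = 0" | "j = 1" | n where "j = Suc (Suc n)"
    by (metis One_nat_def not0_implies_Suc)
  then show ?case
  proof cases
    case 1
    then show ?thesis by simp
  next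
    case 2
    then have "path_op \<alpha> m a m = k * a m" using less.prems by (intro eig) auto
    then have 3: "(1 - \<alpha>) * a (m - 1) = (k - \<alpha>) * a m" by (simp add: path_op_def algebra_simps)
    have "(1 - \<alpha>) * F 2 = (1 - \<alpha>) * (k - \<alpha>)"
      using rec[of 0] init by (simp add: algebra_simps numeral_2_eq_2)
    then have "F 2 = k - \<alpha>" using assms(1) by simp
    then show ?thesis using 2 3 by (simp add: F_def numeral_2_eq_2 mult.commute)
  next
    case 3
    define i where "i = m - Suc n"
    have i: "m - j = i - 1" "m - n = i + 1" "1 \<le> i" "i < m" using 3 less.prems by (auto simp: i_def)
    have "path_op \<alpha> m a i = k * a i" using i by (intro eig) auto
    then have prev: "(1 - \<alpha>) * a (i - 1) = (k - 2 * \<alpha>) * a i - (1 - \<alpha>) * a (i + 1)"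
      using i by (simp add: path_op_def algebra_simps)
    have cur: "(1 - \<alpha>) * a i = a m * F (Suc (Suc n))"
      using less.IH[of "Suc n"] 3 less.prems by (simp add: i_def F_def)
    have nxt: "(1 - \<alpha>) * a (i + 1) = a m * F (Suc n)"
      using less.IH[of n] 3 less.prems i(2) by (simp add: F_def)
    have "(1 - \<alpha>) * ((1 - \<alpha>) * a (i - 1))
        = (k - 2 * \<alpha>) * ((1 - \<alpha>) * a i) - (1 - \<alpha>) * ((1 - \<alpha>) * a (i + 1))"
      unfolding prev by (simp add: algebra_simps)
    also have "\<dots> = (k - 2 * \<alpha>) * (a m * F (Suc (Suc n))) - (1 - \<alpha>) * (a m * F (Suc n))"
      unfolding cur nxt ..
    also have "\<dots> = a m * ((1 - \<alpha>) * F (Suc (Suc (Suc n))))"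
      unfolding rec by (simp add: algebra_simps)
    finally have "(1 - \<alpha>) * ((1 - \<alpha>) * a (i - 1)) = (1 - \<alpha>) * (a m * F (Suc j))"
      using 3 by (simp add: mult_ac)
    then show ?thesis using assms(1) i(1) by (simp add: F_def)
  qed
qed

text \<open>The summand that the first edge of a pendant path adds at the root. The value 0 covers
  the empty path, which occurs for \<open>q = 1\<close>.\<close>

definition path_root_term :: "real \<Rightarrow> nat \<Rightarrow> (nat \<Rightarrow> real) \<Rightarrow> real" where
  "path_root_term \<alpha> m a = (if 1 \<le> m then \<alpha> * a 0 + (1 - \<alpha>) * a 1 else 0)"

text \<open>The scaling \<open>t\<close> cancels in the ratio. For \<open>m = 0\<close> the ratio is
  \<open>- \<alpha> / (1 - \<alpha>)\<close>, so the formula also gives 0 for an empty path.\<close>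

lemma path_root_term_path_seq:
  assumes "\<alpha> < 1" and "path_seq \<alpha> c (Suc m) \<noteq> 0"
    and "\<And>i. i \<le> 1 \<Longrightarrow> i \<le> m \<Longrightarrow> a i = t * path_seq \<alpha> c (Suc (m - i))"
  shows "path_root_term \<alpha> m a = a 0 * (\<alpha> + (1 - \<alpha>) * (path_seq \<alpha> c m / path_seq \<alpha> c (Suc m)))"
proof (cases m)
  case 0
  then show ?thesis using assms(1) by (simp add: path_root_term_def)
next
  case (Suc n)
  then have "a 0 = t * path_seq \<alpha> c (Suc m)" "a 1 = t * path_seq \<alpha> c m"
    using assms(3)[of 0] assms(3)[of 1] by auto
  then show ?thesis using assms(2) Suc by (simp add: path_root_term_def field_simps del: path_seq.simps)
qed

lemma attach_two_paths_vertex_cases: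
  assumes "v \<in> pverts (attach_two_paths G u p q)"
  obtains (base) w where "w \<in> pverts G" "v = Inl (Inl w)"
    | (first) i where "1 \<le> i" "i \<le> p" "v = Inl (Inr i)"
    | (second) i where "1 \<le> i" "i \<le> q" "v = Inr i"
proof (cases v)
  case (Inl w)
  then have "w \<in> pverts (attach_path G u p)"
    using assms by (auto simp: attach_two_paths_def attach_path_def[of _ _ q])
  then show thesis using base first Inl by (cases w) (auto simp: attach_path_def)
next
  case (Inr i)
  then show thesis using assms second by (auto simp: attach_two_paths_def attach_path_def)
qed

lemma A_alpha_op_attach_two_paths:
  fixes p q :: nat
  assumes "pair_graph G" "u \<in> pverts G"
  defines "H \<equiv> attach_two_paths G u p q"
  shows "A_alpha_op \<alpha> H x (Inl (Inl v)) = A_alpha_op \<alpha> G (\<lambda>w. x (Inl (Inl w))) v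
      + (if v = u then path_root_term \<alpha> p (\<lambda>i. x (Inl (path_vertex u i)))
          + path_root_term \<alpha> q (\<lambda>i. x (path_vertex (Inl u) i)) else 0)"
    and "1 \<le> i \<Longrightarrow> i \<le> p \<Longrightarrow>
      A_alpha_op \<alpha> H x (Inl (Inr i)) = path_op \<alpha> p (\<lambda>i. x (Inl (path_vertex u i))) i"
    and "1 \<le> i \<Longrightarrow> i \<le> q \<Longrightarrow>
      A_alpha_op \<alpha> H x (Inr i) = path_op \<alpha> q (\<lambda>i. x (path_vertex (Inl u) i)) i"
proof -
  note pg = pair_graph_attach_path[OF assms(1,2), of p]
  show "A_alpha_op \<alpha> H x (Inl (Inl v)) = A_alpha_op \<alpha> G (\<lambda>w. x (Inl (Inl w))) v
      + (if v = u then path_root_term \<alpha> p (\<lambda>i. x (Inl (path_vertex u i)))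
          + path_root_term \<alpha> q (\<lambda>i. x (path_vertex (Inl u) i)) else 0)"
    unfolding H_def attach_two_paths_def
    by (simp add: A_alpha_op_attach_path_Inl pg assms(1) path_root_term_def path_vertex_def comp_def)
  show "A_alpha_op \<alpha> H x (Inl (Inr i)) = path_op \<alpha> p (\<lambda>i. x (Inl (path_vertex u i))) i"
    if "1 \<le> i" "i \<le> p"
    using that unfolding H_def attach_two_paths_def
    by (simp add: A_alpha_op_attach_path_Inl pg A_alpha_op_attach_path_Inr path_op_def)
      (auto simp: path_vertex_def)
  show "A_alpha_op \<alpha> H x (Inr i) = path_op \<alpha> q (\<lambda>i. x (path_vertex (Inl u) i)) i"
    if "1 \<le> i" "i \<le> q"
    using that unfolding H_def attach_two_paths_def
    by (simp add: A_alpha_op_attach_path_Inr path_op_def) (auto simp: path_vertex_def)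
qed

lemma pair_graph_attach_two_paths:
  assumes "pair_graph G" "u \<in> pverts G"
  shows "pair_graph (attach_two_paths G u p q)"
  unfolding attach_two_paths_def using assms
  by (intro pair_graph_attach_path) (auto simp: attach_path_def)

lemma linked_attach_two_paths:
  assumes "pair_graph G" "linked G" "u \<in> pverts G"
  shows "linked (attach_two_paths G u p q)"
  unfolding attach_two_paths_def using assms
  by (intro linked_attach_path pair_graph_attach_path) (auto simp: attach_path_def)

text \<open>A walk from \<open>u\<close> to the source of some arc either has a first step or is
  empty, and then the arc itself starts at \<open>u\<close>.\<close>

lemma (in pair_graph) linked_imp_neighbour:
  assumes "linked G" "parcs G \<noteq> {}" "u \<in> pverts G"
  obtains w where "(u, w) \<in> parcs G"
proof -
  obtain a b where ab: "(a, b) \<in> parcs G" using assms(2) by auto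
  then have "(u, a) \<in> (parcs G)\<^sup>*" using assms arc_in_verts by (auto simp: linked_def)
  then show thesis using ab that by (cases rule: converse_rtranclE) auto
qed

section \<open>Comparison of the two graphs\<close>

theorem theorem3p5:
  fixes G :: "'a pair_pre_digraph" and u :: 'a and p q :: nat and \<alpha> :: real
  assumes "pair_graph G"
    and "Digraph_Component.connected (with_proj G)"
    and "parcs G \<noteq> {}"
    and "u \<in> pverts G"
    and "p \<ge> q" and "q \<ge> 1"
    and "0 \<le> \<alpha>" and "\<alpha> < 1"
  shows "rho \<alpha> (attach_two_paths G u p q) > rho \<alpha> (attach_two_paths G u (p + 1) (q - 1))"
proof -
  interpret pair_graph G by fact
  define H where "H = attach_two_paths G u (p + 1) (q - 1)"
  define H' where "H' = attach_two_paths G u p q"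
  have link: "linked G" using assms(1,2) by (rule linked_if_connected)
  interpret H: pair_graph H unfolding H_def by (rule pair_graph_attach_two_paths) fact+
  interpret H': pair_graph H' unfolding H'_def by (rule pair_graph_attach_two_paths) fact+
  have base_H: "Inl (Inl v) \<in> pverts H" "Inl (Inl v) \<in> pverts H'" if "v \<in> pverts G" for v
    using that by (auto simp: H_def H'_def attach_two_paths_def attach_path_def)
  define k where "k = rho \<alpha> H"
  define c where "c = (k - 2 * \<alpha>) / (1 - \<alpha>)"
  define F where "F = path_seq \<alpha> c"
  have rec: "F (Suc (Suc n)) = c * F (Suc n) - F n" for n by (simp add: F_def)

  have ne: "pverts H \<noteq> {}" using base_H(1)[OF assms(4)] by auto
  obtain x where x: "\<And>v. 0 \<le> x v" "\<exists>v\<in>pverts H. x v \<noteq> 0"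
    "\<And>v. v \<in> pverts H \<Longrightarrow> A_alpha_op \<alpha> H x v = k * x v"
    by (rule H.rho_top_eigenvector[OF assms(7,8) ne, folded k_def]) (rule that)
  have x_pos: "0 < x v" if "v \<in> pverts H" for v
    using link x that assms H_def
    by (intro H.eigenvector_pos_if_linked[where k = k]) (auto intro: linked_attach_two_paths)

  define z where "z = (\<lambda>v. x (Inl (Inl v)))"
  define a where "a = (\<lambda>i. x (Inl (path_vertex u i)))"
  define b where "b = (\<lambda>i. x (path_vertex (Inl u) i))"
  note H_op = A_alpha_op_attach_two_paths[OF assms(1,4), where p = "p + 1" and q = "q - 1" and \<alpha> = \<alpha> and x = x,
      folded H_def a_def b_def z_def]
  have z_pos: "0 < z v" if "v \<in> pverts G" for v
    using x_pos[OF base_H(1)[OF that]] by (simp add: z_def)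
  have a_pos: "0 < a i" if "i \<le> p + 1" for i
    using that assms(4) unfolding a_def
    by (intro x_pos) (auto simp: H_def attach_two_paths_def attach_path_def path_vertex_def)
  have b_pos: "0 < b i" if "i \<le> q - 1" for i
    using that assms(4) unfolding b_def
    by (intro x_pos) (auto simp: H_def attach_two_paths_def attach_path_def path_vertex_def)
  have a_eig: "path_op \<alpha> (p + 1) a i = k * a i" if "1 \<le> i" "i \<le> p + 1" for i
  proof -
    have "Inl (Inr i) \<in> pverts H"
      using that by (auto simp: H_def attach_two_paths_def attach_path_def)
    from x(3)[OF this] show ?thesis using H_op(2)[OF that] that by (simp add: a_def path_vertex_def)
  qed
  have b_eig: "path_op \<alpha> (q - 1) b i = k * b i" if "1 \<le> i" "i \<le> q - 1" for i
  proof -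
    have "Inr i \<in> pverts H"
      using that by (auto simp: H_def attach_two_paths_def attach_path_def)
    from x(3)[OF this] show ?thesis using H_op(3)[OF that] that by (simp add: b_def path_vertex_def)
  qed
  have a_seq: "(1 - \<alpha>) * a (p + 1 - j) = a (p + 1) * F (Suc j)" if "j \<le> p + 1" for j
    using path_eigenvector_eq_path_seq[OF assms(8) a_eig that] by (simp add: F_def c_def)
  have b_seq: "(1 - \<alpha>) * b (q - 1 - j) = b (q - 1) * F (Suc j)" if "j \<le> q - 1" for j
    using path_eigenvector_eq_path_seq[OF assms(8) b_eig that] by (simp add: F_def c_def)
  \<comment> \<open>The path of length \<open>p + 1\<close> in \<open>H\<close> carries a positive
    multiple of \<open>F\<close> at the indices 1 to \<open>p + 2\<close>, which include all
    positive indices needed for \<open>H'\<close>.\<close>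
  have F_pos: "0 < F i" if "1 \<le> i" "i \<le> p + 2" for i
  proof -
    obtain j where j: "i = Suc j" using \<open>1 \<le> i\<close> by (cases i) auto
    have "0 < (1 - \<alpha>) * a (p + 1 - j)" using a_pos assms(8) by simp
    then have "0 < a (p + 1) * F i" using a_seq[of j] that j by simp
    then show ?thesis using a_pos[of "p + 1"] by (simp add: zero_less_mult_iff)
  qed
  have a_root: "path_root_term \<alpha> (p + 1) a = z u * (\<alpha> + (1 - \<alpha>) * (F (p + 1) / F (p + 2)))"
  proof -
    define t where "t = a (p + 1) / (1 - \<alpha>)"
    have "a i = t * F (Suc (p + 1 - i))" if "i \<le> p + 1" for i
      using a_seq[OF diff_le_self[of "p + 1" i], unfolded diff_diff_cancel[OF that]] assms(8)
      by (simp add: t_def field_simps)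
    moreover have "F (Suc (p + 1)) \<noteq> 0" using F_pos[of "Suc (p + 1)"] assms(5,6) by simp
    ultimately have "path_root_term \<alpha> (p + 1) a = a 0 * (\<alpha> + (1 - \<alpha>) * (F (p + 1) / F (Suc (p + 1))))"
      unfolding F_def by (intro path_root_term_path_seq[OF assms(8)])
    then show ?thesis by (simp add: a_def z_def path_vertex_def)
  qed
  have b_root: "path_root_term \<alpha> (q - 1) b = z u * (\<alpha> + (1 - \<alpha>) * (F (q - 1) / F q))"
  proof -
    define t where "t = b (q - 1) / (1 - \<alpha>)"
    have "b i = t * F (Suc (q - 1 - i))" if "i \<le> q - 1" for i
      using b_seq[OF diff_le_self[of "q - 1" i], unfolded diff_diff_cancel[OF that]] assms(8)
      by (simp add: t_def field_simps)
    moreover have "F (Suc (q - 1)) \<noteq> 0" using F_pos[of "Suc (q - 1)"] assms(5,6) by simp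
    ultimately have "path_root_term \<alpha> (q - 1) b = b 0 * (\<alpha> + (1 - \<alpha>) * (F (q - 1) / F (Suc (q - 1))))"
      unfolding F_def by (intro path_root_term_path_seq[OF assms(8)])
    then show ?thesis using assms(6) by (simp add: b_def z_def path_vertex_def)
  qed

  define g where "g = A_alpha_op \<alpha> G z u"
  \<comment> \<open>The assumption of at least one edge enters here, through a neighbour of
    \<open>u\<close> inside \<open>G\<close>.\<close>
  have "0 < g"
  proof -
    obtain w where w: "(u, w) \<in> parcs G" using linked_imp_neighbour[OF link assms(3,4)] .
    have "0 < \<alpha> * z u + (1 - \<alpha>) * z w'" if "(u, w') \<in> parcs G" for w'
      using that z_pos[of w'] z_pos[of u] arc_in_verts[of u w'] assms(4,7,8)
      by (intro add_nonneg_pos) auto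
    then show ?thesis unfolding g_def A_alpha_op_def
      using w finite_neighbours by (intro sum_pos) auto
  qed
  have root_eq: "k * z u = g + z u * (\<alpha> + (1 - \<alpha>) * (F (p + 1) / F (p + 2)))
      + z u * (\<alpha> + (1 - \<alpha>) * (F (q - 1) / F q))"
    using x(3)[OF base_H(1)[OF assms(4)]] H_op(1)[of u] unfolding a_root b_root
    by (simp add: z_def g_def)
  have F_ineq: "F (p + 1) * F q < F (p + 2) * F (q + 1)"
  proof -
    have k_eq: "k = c * (1 - \<alpha>) + 2 * \<alpha>" using assms(8) by (simp add: c_def)
    \<comment> \<open>Expressing \<open>k\<close> through \<open>c\<close> cancels the two summands
      \<open>\<alpha> * z u\<close> from the path edges, so positivity of \<open>g\<close> bounds
      the two ratios by \<open>c\<close>.\<close>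
    have "g = z u * (1 - \<alpha>) * (c - F (p + 1) / F (p + 2) - F (q - 1) / F q)"
      using root_eq unfolding k_eq by (simp add: algebra_simps)
    moreover have "0 < z u * (1 - \<alpha>)" using z_pos[OF assms(4)] assms(8) by simp
    ultimately have "0 < c - F (p + 1) / F (p + 2) - F (q - 1) / F q"
      using \<open>0 < g\<close> by (simp only: zero_less_mult_pos)
    moreover have pos: "0 < F (p + 2)" "0 < F q" using F_pos assms(5,6) by auto
    ultimately have "0 < (c - F (p + 1) / F (p + 2) - F (q - 1) / F q) * (F (p + 2) * F q)"
      by simp
    also have "\<dots> = F (p + 2) * (c * F q - F (q - 1)) - F (p + 1) * F q"
      using pos by (simp add: field_simps)
    also have "c * F q - F (q - 1) = F (q + 1)" using rec[of "q - 1"] assms(6) by simp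
    finally show ?thesis by simp
  qed
  have ratio: "F (p + 1) / F (p + 2) + F (q - 1) / F q < F p / F (p + 1) + F q / F (q + 1)"
    using rec F_pos assms(5,6) F_ineq assms(7)
    by (intro linear_recurrence_ratio_less[where c = c]) (auto simp: F_def)

  \<comment> \<open>The scaling factors make both path sequences equal to \<open>z u\<close> at
    index 0.\<close>
  define y where "y = case_sum (case_sum z (\<lambda>i. z u / F (p + 1) * F (Suc (p - i))))
      (\<lambda>i. z u / F (q + 1) * F (Suc (q - i)))"
  have Fpq: "0 < F (p + 1)" "0 < F (q + 1)" using F_pos assms(5) by auto
  have ya: "(\<lambda>i. y (Inl (path_vertex u i))) = (\<lambda>i. z u / F (p + 1) * F (Suc (p - i)))"
    using Fpq by (auto simp: y_def path_vertex_def fun_eq_iff)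
  have yb: "(\<lambda>i. y (path_vertex (Inl u) i)) = (\<lambda>i. z u / F (q + 1) * F (Suc (q - i)))"
    using Fpq by (auto simp: y_def path_vertex_def fun_eq_iff)
  have yz: "(\<lambda>v. y (Inl (Inl v))) = z" by (simp add: y_def)
  note H'_op = A_alpha_op_attach_two_paths[OF assms(1,4), where p = p and q = q and \<alpha> = \<alpha> and x = y,
      folded H'_def, unfolded ya yb yz]
  have ya_root: "path_root_term \<alpha> p (\<lambda>i. z u / F (p + 1) * F (Suc (p - i)))
      = z u * (\<alpha> + (1 - \<alpha>) * (F p / F (p + 1)))"
    using path_root_term_path_seq[of \<alpha> c p "\<lambda>i. z u / F (p + 1) * F (Suc (p - i))" "z u / F (p + 1)"]
      assms(8) Fpq by (simp add: F_def)
  have yb_root: "path_root_term \<alpha> q (\<lambda>i. z u / F (q + 1) * F (Suc (q - i)))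
      = z u * (\<alpha> + (1 - \<alpha>) * (F q / F (q + 1)))"
    using path_root_term_path_seq[of \<alpha> c q "\<lambda>i. z u / F (q + 1) * F (Suc (q - i))" "z u / F (q + 1)"]
      assms(8) Fpq by (simp add: F_def)
  have root: "k * y (Inl (Inl u)) < A_alpha_op \<alpha> H' y (Inl (Inl u))"
  proof -
    define r where "r = F (p + 1) / F (p + 2) + F (q - 1) / F q"
    define r' where "r' = F p / F (p + 1) + F q / F (q + 1)"
    \<comment> \<open>The eigenvalue equation of \<open>x\<close> at \<open>u\<close> and the
      operator applied to \<open>y\<close> there differ only in the sum of ratios, \<open>r\<close>
      against \<open>r'\<close>.\<close>
    have "k * y (Inl (Inl u)) = g + 2 * \<alpha> * z u + z u * (1 - \<alpha>) * r"
      using root_eq by (simp add: y_def r_def algebra_simps)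
    also have "\<dots> < g + 2 * \<alpha> * z u + z u * (1 - \<alpha>) * r'"
      using ratio z_pos[OF assms(4)] assms(8)
      by (intro add_strict_left_mono mult_strict_left_mono) (auto simp: r_def r'_def)
    also have "\<dots> = A_alpha_op \<alpha> H' y (Inl (Inl u))"
      unfolding H'_op(1) ya_root yb_root g_def[symmetric]
      by (simp add: r'_def algebra_simps diff_divide_distrib)
    finally show ?thesis .
  qed
  have "k * y v \<le> A_alpha_op \<alpha> H' y v \<and> 0 \<le> y v" if "v \<in> pverts H'" for v
    using that[unfolded H'_def]
  proof (cases rule: attach_two_paths_vertex_cases)
    case (base w)
    show ?thesis
    proof (cases "w = u")
      case True
      then show ?thesis using root base z_pos[of u] by (simp add: y_def)
    next
      case False
      \<comment> \<open>Away from \<open>u\<close> neither path contributes, so the equation carries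
        over from \<open>H\<close>.\<close>
      then have "A_alpha_op \<alpha> H' y (Inl (Inl w)) = k * z w"
        using H'_op(1)[of w] H_op(1)[of w] x(3)[OF base_H(1)[OF base(1)]] by (simp add: z_def)
      then show ?thesis using base z_pos[of w] by (simp add: y_def)
    qed
  next
    case (first i)
    have "0 < F (Suc (p - i))" by (rule F_pos) auto
    then have "0 \<le> z u / F (p + 1) * F (Suc (p - i))"
      using z_pos[OF assms(4)] Fpq(1) by simp
    then show ?thesis
      using H'_op(2)[OF first(1,2)] path_op_path_seq[OF assms(8) first(1,2), of "z u / F (p + 1)" k]
        first
      by (simp add: y_def F_def c_def)
  next
    case (second i)
    have "0 < F (Suc (q - i))" using assms(5) by (intro F_pos) auto
    then have "0 \<le> z u / F (q + 1) * F (Suc (q - i))"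
      using z_pos[OF assms(4)] Fpq(2) by simp
    then show ?thesis
      using H'_op(3)[OF second(1,2)] path_op_path_seq[OF assms(8) second(1,2), of "z u / F (q + 1)" k]
        second
      by (simp add: y_def F_def c_def)
  qed
  then have "k < rho \<alpha> H'"
    using base_H(2)[OF assms(4)] z_pos[OF assms(4)] root assms(7,8)
    by (intro H'.less_rho_if_subinvariant[where y = y and u = "Inl (Inl u)"]) (auto simp: y_def)
  then show ?thesis by (simp add: k_def H_def H'_def)
qed

end
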